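(* Let $r\ge 3$ be odd, let $n\ge r+1$, and let $m$ be an integer with $r+1\le m\le n$. Let $g=\Psi_{2,n}^{(r-1,r)}f$ for some $f\in\mathcal{H}_n^{(r-1)}(\mathbb{F}_2)$, where $(\Psi_{2,n}^{(r-1,r)}f)(e)=\sum_{e'\subseteq e,\ |e'|=r-1} f(e')$ for every $r$-element subset $e$ of the vertex set $V$. Then $K_m^{(r)}-e$ never occurs as an induced subhypergraph in either color of $g$; that is, there is no $m$-element set $X\subseteq V$ and color $c\in\mathbb{F}_2$ such that exactly one $r$-element subset of $X$ has $g$-color different from $c$ and all other $r$-element subsets of $X$ have $g$-color $c$.
   Context: $\mathbb{F}_2$ is the field with two elements. For $2\le k\le n$, $K_n^{(k)}$ is the complete $k$-uniform hypergraph on a fixed $n$-element vertex set $V$ (hyperedges: all $k$-element subsets of $V$), and $\mathcal{H}_n^{(k)}(\mathbb{F}_2)$ is the set of all maps $E(K_n^{(k)})\to\mathbb{F}_2$. $K_m^{(r)}-e$ denotes the complete $r$-uniform hypergraph on $m$ vertices with one hyperedge removed. *)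

theory Defs
  imports "HOL-Library.Z2" "HOL-Library.FuncSet"
begin

definition complete_edges :: "'a set \<Rightarrow> nat \<Rightarrow> 'a set set" where
  "complete_edges V k = {e. e \<subseteq> V \<and> card e = k}"

text \<open>
  \<^typ>\<open>bit\<close> is the field with two elements. Maps defined only on the hyperedges are
  represented as extensional functions.
\<close>

definition colorings :: "'a set \<Rightarrow> nat \<Rightarrow> ('a set \<Rightarrow> bit) set" where
  "colorings V k = complete_edges V k \<rightarrow>\<^sub>E UNIV"

definition Psi :: "'a set \<Rightarrow> nat \<Rightarrow> nat \<Rightarrow> ('a set \<Rightarrow> bit) \<Rightarrow> ('a set \<Rightarrow> bit)" where
  "Psi V k r f = (\<lambda>e\<in>complete_edges V r. \<Sum>e'\<in>complete_edges e k. f e')"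

end

theory Submission
  imports Defs
begin

text \<open>
  The function \<open>g\<close> is a coboundary over the field with two elements: on an \<open>(r + 1)\<close>-set \<open>Y\<close>
  every \<open>(r - 1)\<close>-subset lies in exactly two \<open>r\<close>-subsets, so the values of \<open>g\<close> on the \<open>r\<close>-subsets
  of \<open>Y\<close> sum to \<open>0\<close>. If all but one of these \<open>r + 1\<close> values were \<open>c\<close> and the remaining one were
  \<open>c + 1\<close>, they would sum to \<open>(r + 1) c + 1\<close>, which is \<open>1\<close> as \<open>r\<close> is odd. Any \<open>Y\<close> between the
  exceptional edge and \<open>X\<close> thus gives a contradiction.
\<close>

lemma finite_complete_edges: "finite V \<Longrightarrow> finite (complete_edges V k)"
  by (simp add: complete_edges_def)

lemma card_complete_edges: "finite V \<Longrightarrow> card (complete_edges V k) = card V choose k"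
  by (simp add: complete_edges_def n_subsets)

text \<open>Each such \<open>e\<close> arises from \<open>d\<close> by adding a single point of
  \<open>Y - d\<close>, and different points give different sets.\<close>

lemma card_complete_edges_Suc_containing:
  assumes "finite Y" "d \<in> complete_edges Y k"
  shows "card {e \<in> complete_edges Y (Suc k). d \<subseteq> e} = card Y - k"
proof -
  have d: "d \<subseteq> Y" "card d = k" "finite d"
    using assms by (auto simp: complete_edges_def intro: finite_subset)
  have "{e \<in> complete_edges Y (Suc k). d \<subseteq> e} = (\<lambda>y. insert y d) ` (Y - d)"
  proof (intro equalityI subsetI)
    fix e assume e: "e \<in> {e \<in> complete_edges Y (Suc k). d \<subseteq> e}"
    then have "card (e - d) = 1"
      using d by (simp add: complete_edges_def card_Diff_subset)
    then obtain y where "e - d = {y}" by (auto simp: card_1_singleton_iff)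
    then have "e = insert y d" "y \<in> Y - d"
      using e by (auto simp: complete_edges_def)
    then show "e \<in> (\<lambda>y. insert y d) ` (Y - d)" by blast
  qed (use d in \<open>auto simp: complete_edges_def\<close>)
  moreover have "inj_on (\<lambda>y. insert y d) (Y - d)"
    by (auto simp: inj_on_def)
  ultimately show ?thesis
    using d by (simp add: card_image card_Diff_subset)
qed

lemma sum_coboundary_eq_0:
  fixes f :: "'a set \<Rightarrow> bit"
  assumes "finite Y" "card Y = k + 2"
  shows "(\<Sum>e\<in>complete_edges Y (Suc k). \<Sum>d\<in>complete_edges e k. f d) = 0"
proof -
  \<comment> \<open>Letting \<open>d\<close> range over subsets of the fixed set \<open>Y\<close>
    makes the two sums exchangeable.\<close>
  have "(\<Sum>e\<in>complete_edges Y (Suc k). \<Sum>d\<in>complete_edges e k. f d)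
      = (\<Sum>e\<in>complete_edges Y (Suc k). \<Sum>d\<in>{d \<in> complete_edges Y k. d \<subseteq> e}. f d)"
    by (intro sum.cong) (auto simp: complete_edges_def)
  also have "\<dots> = (\<Sum>d\<in>complete_edges Y k. \<Sum>e\<in>{e \<in> complete_edges Y (Suc k). d \<subseteq> e}. f d)"
    using assms(1) by (intro sum.swap_restrict finite_complete_edges)
  \<comment> \<open>Each \<open>f d\<close> now occurs \<open>card Y - k = 2\<close> times, so it
    cancels in characteristic 2.\<close>
  also have "\<dots> = 0"
    using assms
    by (simp only: sum_constant card_complete_edges_Suc_containing diff_add_inverse
        of_nat_numeral bit_2_eq_0 mult_zero_left mult_zero_right cong: sum.cong)
  finally show ?thesis .
qed

theorem theorem7:
  fixes V :: "'a set" and n r m :: nat and f g :: "'a set \<Rightarrow> bit"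
  assumes "finite V" and "card V = n"
    and "r \<ge> 3" and "odd r" and "n \<ge> r + 1"
    and "r + 1 \<le> m" and "m \<le> n"
    and "f \<in> colorings V (r - 1)"
    and "g = Psi V (r - 1) r f"
  shows "\<not> (\<exists>X c. X \<subseteq> V \<and> card X = m \<and>
           (\<exists>e\<in>complete_edges X r. g e \<noteq> c \<and>
              (\<forall>e'\<in>complete_edges X r - {e}. g e' = c)))"
proof (intro notI, elim exE conjE bexE)
  fix X c e
  assume X: "X \<subseteq> V" "card X = m" and e: "e \<in> complete_edges X r"
    and ne: "g e \<noteq> c" and eq: "\<forall>e'\<in>complete_edges X r - {e}. g e' = c"
  have finX: "finite X" using X assms(1) finite_subset by blast
  obtain Y where Y: "e \<subseteq> Y" "Y \<subseteq> X" "card Y = r + 1"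
    using exists_subset_between[of e "r + 1" X] e X(2) finX assms(6)
    by (auto simp: complete_edges_def)
  have finY: "finite Y" using Y finX finite_subset by blast
  have eY: "e \<in> complete_edges Y r"
    using Y e by (auto simp: complete_edges_def)
  \<comment> \<open>Edges of \<open>Y\<close> are edges of \<open>V\<close>, so \<open>Psi\<close>
    has its defining sum there and not the default \<open>undefined\<close>.\<close>
  have "(\<Sum>e'\<in>complete_edges Y r. g e')
      = (\<Sum>e'\<in>complete_edges Y r. \<Sum>d\<in>complete_edges e' (r - 1). f d)"
    using Y X assms(9) by (intro sum.cong) (auto simp: Psi_def complete_edges_def)
  also have "\<dots> = 0"
    using sum_coboundary_eq_0[of Y "r - 1" f] finY Y(3) assms(3) by simp
  finally have sum0: "(\<Sum>e'\<in>complete_edges Y r. g e') = 0" .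
  have "(\<Sum>e'\<in>complete_edges Y r - {e}. g e') = (\<Sum>e'\<in>complete_edges Y r - {e}. c)"
  proof (intro sum.cong refl)
    fix e' assume "e' \<in> complete_edges Y r - {e}"
    then have "e' \<in> complete_edges X r - {e}"
      using Y by (auto simp: complete_edges_def)
    with eq show "g e' = c" by (rule bspec)
  qed
  also have "\<dots> = of_nat (card (complete_edges Y r - {e})) * c"
    by (rule sum_constant)
  \<comment> \<open>\<open>Y\<close> has \<open>(r + 1) choose r = r + 1\<close> edges, one of which
    is \<open>e\<close>.\<close>
  also have "card (complete_edges Y r - {e}) = r"
    using eY finY Y(3) by (simp add: card_complete_edges finite_complete_edges)
  also have "of_nat r = (1 :: bit)"
    using assms(4)
    by (elim oddE) (simp only: of_nat_add of_nat_mult of_nat_numeral bit_2_eq_0 mult_zero_left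
        add_0_left of_nat_1)
  finally have "(\<Sum>e'\<in>complete_edges Y r - {e}. g e') = c"
    by (simp only: mult_1_left)
  then have "g e + c = 0"
    using sum0 sum.remove[OF finite_complete_edges[OF finY] eY, of g] by (simp only:)
  \<comment> \<open>Negation on \<open>bit\<close> is the identity, so a vanishing sum of two values
    makes them equal.\<close>
  then have "c = g e"
    by (simp only: add_eq_0_iff uminus_bit_def id_apply)
  with ne show False by blast
qed

end
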